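(* Suppose the field-free-point (FFP) trajectory is given by a complex trigonometric waveform and a linear shift focus field, $$\xi(t)=A e^{i2\pi f_0 t}+t\cdot\Delta_t ,$$ where $|\gamma A|<\pi$ and $\Delta_t$ is a linear shift rate constant, and let the particle density be a single point source $\rho(x)=\delta(x-x_0)$. Then the noise-free and unfiltered 1D MPI received signal is given by $$s_0(t)= i2\pi m f_0\, b_1(x_0)\sum_{k=1}^{\infty}\frac{(\gamma A)^k}{(k-1)!}\,\mathcal L^{(k)}\!\left[\gamma\,(t\Delta_t-x_0)\right]e^{i2\pi f_0 k t}+O(\Delta_t),$$ where $\mathcal L^{(k)}$ is the $k$-th derivative of the Langevin function $\mathcal L$.
   Context: The Langevin function is $\mathcal L(z)=\coth(z)-1/z$ (with the removable singularity at $z=0$ filled in), regarded also as a function of a complex argument away from its poles at $i k\pi$, $k$ a nonzero integer. 1D magnetic particle imaging (MPI) signal model: there is a static linear magnetic field $Gx$, and the total field at position $x$ and time $t$ is $H(x,t)=G(\xi(t)-x)$, where $\xi(t)$ is the FFP location, allowed here to be complex-valued (a complex exponential drive is used for mathematical convenience). The constant $\gamma=\beta G>0$ combines the particle constant $\beta$ and the gradient $G$; $m$ is the magnetic moment; $f_0$ is the drive frequency; $A$ is the drive amplitude expressed as an FFP displacement; $b_1(x)$ is the receive coil sensitivity; $x_0$ is the location of the point source. For a particle density $\rho$ the noise-free, unfiltered received signal is $$s_0(t)=m\,\frac{d}{dt}\int b_1(x)\,\rho(x)\,\mathcal L\!\left[\gamma(\xi(t)-x)\right]dx ,$$ where for $\rho(x)=\delta(x-x_0)$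 (Dirac delta) the integral is understood as evaluation at $x_0$. The symbol $O(\Delta_t)$ denotes a term of order $\Delta_t$. *)

theory Defs
  imports "HOL-Probability.Probability"
begin

definition langevin :: "complex \<Rightarrow> complex" where
  "langevin z = (if z = 0 then 0 else cosh z / sinh z - 1 / z)"

text \<open>
  The particle density enters as a measure on the real line; an ordinary density
  function \<open>r\<close> corresponds to \<^term>\<open>density lborel r\<close>.
\<close>

definition particle_response ::
  "(real \<Rightarrow> real) \<Rightarrow> real measure \<Rightarrow> real \<Rightarrow> (real \<Rightarrow> complex) \<Rightarrow> real \<Rightarrow> complex" where
  "particle_response b1 \<rho> \<gamma> \<xi> t =
     (\<integral>x. of_real (b1 x) * langevin (of_real \<gamma> * (\<xi> t - of_real x)) \<partial>\<rho>)"

definition received_signal ::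
  "real \<Rightarrow> (real \<Rightarrow> real) \<Rightarrow> real measure \<Rightarrow> real \<Rightarrow> (real \<Rightarrow> complex) \<Rightarrow> real \<Rightarrow> complex" where
  "received_signal m b1 \<rho> \<gamma> \<xi> t =
     of_real m * vector_derivative (particle_response b1 \<rho> \<gamma> \<xi>) (at t)"

text \<open>
  The Dirac measure is taken on the discrete sigma-algebra, so that integration against
  it is evaluation at \<open>x0\<close> for every integrand and the coil sensitivity need not be
  measurable.
\<close>

definition point_source :: "real \<Rightarrow> real measure" where
  "point_source x0 = return (count_space UNIV) x0"

definition ffp_trajectory :: "complex \<Rightarrow> real \<Rightarrow> real \<Rightarrow> real \<Rightarrow> complex" where
  "ffp_trajectory A f0 \<Delta> t =
     A * exp (\<i> * of_real (2 * pi * f0 * t)) + of_real (t * \<Delta>)"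

text \<open>Used for \<open>k \<ge> 1\<close> only.\<close>

definition harmonic_term ::
  "real \<Rightarrow> complex \<Rightarrow> real \<Rightarrow> real \<Rightarrow> real \<Rightarrow> real \<Rightarrow> nat \<Rightarrow> complex" where
  "harmonic_term \<gamma> A f0 x0 \<Delta> t k =
     (of_real \<gamma> * A) ^ k / fact (k - 1)
     * (deriv ^^ k) langevin (of_real (\<gamma> * (t * \<Delta> - x0)))
     * exp (\<i> * of_real (2 * pi * f0 * real k * t))"

end

theory Submission
  imports Defs "HOL-Complex_Analysis.Complex_Analysis"
begin

text \<open>
  On the strip \<open>\<bar>Im z\<bar> < pi\<close> the Langevin function is holomorphic, so the signal is
  \<open>m * b1 x0 * L' (u + w) * (2 * pi * i * f0 * w + \<gamma> * \<Delta>)\<close> with \<open>u = \<gamma> (t \<Delta> - x0)\<close> real and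
  \<open>w = \<gamma> A exp (2 * pi * i * f0 * t)\<close>. Expanding \<open>L'\<close> in its Taylor series about \<open>u\<close> turns the
  first summand into the harmonic series. The remainder is \<open>\<Delta>\<close> times a value of \<open>L'\<close> on the
  strip \<open>\<bar>Im z\<bar> \<le> cmod (\<gamma> A)\<close>, where \<open>L'\<close> is bounded.
\<close>

text \<open>A zero of \<open>sinh\<close> satisfies \<open>exp (2 * z) = 1\<close>, hence is an
  integer multiple of \<open>\<i> * pi\<close>; the strip contains only the multiple 0.\<close>

lemma sinh_nonzero_strip:
  fixes z :: complex
  assumes "z \<noteq> 0" "\<bar>Im z\<bar> < pi"
  shows "sinh z \<noteq> 0"
proof
  assume "sinh z = 0"
  then have "exp z = exp (- z)"
    by (simp add: sinh_def)
  then have "exp (2 * z) = 1"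
    by (metis exp_add exp_minus_inverse mult_2)
  then obtain n :: int where re: "Re z = 0" and n: "2 * Im z = of_int (2 * n) * pi"
    by (auto simp: exp_eq_1)
  have "Im z = of_int n * pi"
    using n by simp
  then have "\<bar>of_int n\<bar> * pi < 1 * pi"
    using assms(2) by (simp add: abs_mult)
  then have "\<bar>n\<bar> < 1"
    by (simp only: mult_less_cancel_right_pos[OF pi_gt_zero])
  then have "n = 0"
    by simp
  then show False
    using re \<open>Im z = of_int n * pi\<close> assms(1) by (simp add: complex_eq_iff)
qed

text \<open>By the chain rule at 0, the derivative of an even function there equals its own
  negative.\<close>

lemma deriv_even_0:
  fixes f :: "complex \<Rightarrow> complex"
  assumes "\<And>z. f (- z) = f z" "f field_differentiable at 0"
  shows "deriv f 0 = 0"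
proof -
  have D: "(f has_field_derivative deriv f 0) (at 0)"
    using assms(2) by (simp add: field_differentiable_derivI)
  have "((\<lambda>z. f (- z)) has_field_derivative deriv f 0 * (- 1)) (at 0)"
    by (rule DERIV_chain2[where f=f]) (use D in \<open>auto intro!: derivative_eq_intros\<close>)
  then have "(f has_field_derivative - deriv f 0) (at 0)"
    by (simp add: assms(1))
  from DERIV_unique[OF D this] show ?thesis
    by simp
qed

text \<open>Away from 0, \<open>langevin z\<close> is the quotient of \<open>p z / z\<close> by
  \<open>g z\<close>. Both extend to entire functions, and \<open>g\<close> has no zero in the
  strip, so the singularity at 0 disappears.\<close>

lemma holomorphic_langevin: "langevin holomorphic_on {z. \<bar>Im z\<bar> < pi}"
proof -
  define g :: "complex \<Rightarrow> complex" where "g = (\<lambda>z. if z = 0 then 1 else sinh z / z)"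
  define p where "p = (\<lambda>z. cosh z - g z)"
  have "deriv sinh (0 :: complex) = 1"
    by (rule DERIV_imp_deriv) (auto intro!: derivative_eq_intros)
  moreover have "sinh holomorphic_on (UNIV :: complex set)"
    by (intro analytic_imp_holomorphic analytic_on_sinh[OF analytic_on_ident])
  ultimately have g: "g holomorphic_on UNIV"
    by (intro pole_theorem_open_0[where a=0 and f=g and g=sinh]) (auto simp: g_def)
  have p: "p holomorphic_on UNIV"
    unfolding p_def
    by (intro holomorphic_on_diff g analytic_imp_holomorphic analytic_on_cosh analytic_on_ident)
  \<comment> \<open>Filling the singularity of \<open>p z / z\<close> yields the value
    \<open>deriv p 0\<close>. Evenness of \<open>p\<close> makes it 0, in agreement with
    \<open>langevin 0 = 0\<close>.\<close>
  have "deriv p 0 = 0"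
    by (rule deriv_even_0)
      (use p in \<open>auto simp: p_def g_def holomorphic_on_def\<close>)
  then have q: "(\<lambda>z. if z = 0 then 0 else p z / z) holomorphic_on UNIV"
    using pole_lemma_open[OF p open_UNIV, of 0] by (simp add: p_def g_def cong: if_cong)
  have "(\<lambda>z. (if z = 0 then 0 else p z / z) / g z) holomorphic_on {z. \<bar>Im z\<bar> < pi}"
    by (intro holomorphic_on_divide holomorphic_on_subset[OF g] holomorphic_on_subset[OF q])
      (auto simp: g_def sinh_nonzero_strip)
  then show ?thesis
    by (rule holomorphic_transform)
      (auto simp: langevin_def p_def g_def sinh_nonzero_strip field_simps)
qed

lemma open_strip: "open {z. \<bar>Im z\<bar> < c}"
  by (intro open_Collect_less continuous_intros)

lemma deriv_langevin:
  assumes "z \<noteq> 0" "\<bar>Im z\<bar> < pi"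
  shows "deriv langevin z = 1 / z ^ 2 - 1 / sinh z ^ 2"
proof -
  have nz: "sinh z \<noteq> 0"
    using assms by (rule sinh_nonzero_strip)
  have "((\<lambda>z. cosh z / sinh z - 1 / z) has_field_derivative 1 / z ^ 2 - 1 / sinh z ^ 2) (at z)"
    using assms(1) nz cosh_square_eq[of z]
    by (auto intro!: derivative_eq_intros simp: power2_eq_square field_simps)
  then have "(langevin has_field_derivative 1 / z ^ 2 - 1 / sinh z ^ 2) (at z)"
    by (rule has_field_derivative_transform_within_open[where S="- {0}"])
      (use assms(1) in \<open>auto simp: langevin_def\<close>)
  then show ?thesis
    by (rule DERIV_imp_deriv)
qed

text \<open>The reverse triangle inequality for \<open>exp z\<close> and \<open>exp (- z)\<close>,
  whose moduli depend on \<open>Re z\<close> only, reduces the claim to the real bound |x| \<le>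
  |sinh x|.\<close>

lemma abs_Re_le_norm_sinh: "\<bar>Re z\<bar> \<le> cmod (sinh z)"
proof -
  have "\<bar>Re z\<bar> \<le> \<bar>sinh (Re z)\<bar>"
    using real_le_abs_sinh[of "Re z"] by (simp add: sinh_field_def exp_minus)
  also have "\<dots> = \<bar>cmod (exp z) - cmod (exp (- z))\<bar> / 2"
    by (simp add: sinh_field_def norm_exp_eq_Re)
  also have "\<dots> \<le> cmod (exp z - exp (- z)) / 2"
    using norm_triangle_ineq3 by (rule divide_right_mono) simp
  also have "\<dots> = cmod (sinh z)"
    by (simp add: sinh_field_def norm_divide)
  finally show ?thesis .
qed

text \<open>The strip is unbounded, so compactness covers only |Re z| \<le> 1; beyond that the
  explicit formula for the derivative takes over. Strictness of \<open>r < pi\<close> keeps the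
  closed strip away from the poles.\<close>

lemma deriv_langevin_bounded:
  assumes "r < pi"
  obtains B where "\<And>z. \<bar>Im z\<bar> \<le> r \<Longrightarrow> cmod (deriv langevin z) \<le> B"
proof -
  define K where "K = cbox (Complex (- 1) (- r)) (Complex 1 r)"
  have "deriv langevin holomorphic_on {z. \<bar>Im z\<bar> < pi}"
    by (intro holomorphic_deriv holomorphic_langevin open_strip)
  then have "continuous_on K (deriv langevin)"
    by (intro holomorphic_on_imp_continuous_on, elim holomorphic_on_subset)
      (use assms in \<open>auto simp: K_def in_cbox_complex_iff\<close>)
  then have "bounded (deriv langevin ` K)"
    unfolding K_def by (intro compact_imp_bounded compact_continuous_image compact_cbox)
  then obtain C where C: "\<And>z. z \<in> K \<Longrightarrow> cmod (deriv langevin z) \<le> C"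
    by (auto simp: bounded_iff)
  \<comment> \<open>\<open>C\<close> serves the rectangle \<open>K\<close>; 2 serves the rest, where
    both summands of the formula have modulus at most 1.\<close>
  have "cmod (deriv langevin z) \<le> max C 2" if z: "\<bar>Im z\<bar> \<le> r" for z
  proof (cases "\<bar>Re z\<bar> \<le> 1")
    case True
    then have "z \<in> K"
      using z by (auto simp: K_def in_cbox_complex_iff)
    then show ?thesis
      using C by (simp add: le_max_iff_disj)
  next
    case False
    then have "1 \<le> cmod z" "1 \<le> cmod (sinh z)" "z \<noteq> 0"
      using abs_Re_le_cmod[of z] abs_Re_le_norm_sinh[of z] by auto
    then have "cmod (1 / z ^ 2) \<le> 1" "cmod (1 / sinh z ^ 2) \<le> 1"
      by (simp_all add: norm_divide norm_power divide_le_eq_1 one_le_power)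
    moreover have "deriv langevin z = 1 / z ^ 2 - 1 / sinh z ^ 2"
      using z assms \<open>z \<noteq> 0\<close> by (intro deriv_langevin) auto
    ultimately have "cmod (deriv langevin z) \<le> 2"
      using norm_triangle_ineq4[of "1 / z ^ 2" "1 / sinh z ^ 2"] by simp
    then show ?thesis
      by simp
  qed
  then show ?thesis
    using that by blast
qed

lemma particle_response_point_source:
  "particle_response b1 (point_source x0) \<gamma> \<xi> t
    = of_real (b1 x0) * langevin (of_real \<gamma> * (\<xi> t - of_real x0))"
  unfolding particle_response_def point_source_def by (rule integral_return) auto

text \<open>This is the \<open>w\<close> of the overview: the sinusoidal part of the argument of
  \<open>langevin\<close>. Its modulus is constant in time.\<close>

definition drive_phase :: "real \<Rightarrow> complex \<Rightarrow> real \<Rightarrow> real \<Rightarrow> complex" where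
  "drive_phase \<gamma> A f0 t = of_real \<gamma> * A * exp (\<i> * of_real (2 * pi * f0 * t))"

lemma norm_drive_phase: "cmod (drive_phase \<gamma> A f0 t) = cmod (of_real \<gamma> * A)"
  by (simp add: drive_phase_def norm_mult norm_exp_eq_Re)

lemma ffp_trajectory_drive_phase:
  "of_real \<gamma> * (ffp_trajectory A f0 \<Delta> t - of_real x0)
    = of_real (\<gamma> * (t * \<Delta> - x0)) + drive_phase \<gamma> A f0 t"
  by (simp add: ffp_trajectory_def drive_phase_def algebra_simps)

lemma particle_response_has_vector_derivative:
  assumes "cmod (of_real \<gamma> * A) < pi"
  shows "(particle_response b1 (point_source x0) \<gamma> (ffp_trajectory A f0 \<Delta>) has_vector_derivative
      of_real (b1 x0) * deriv langevin (of_real (\<gamma> * (t * \<Delta> - x0)) + drive_phase \<gamma> A f0 t)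
        * (\<i> * of_real (2 * pi * f0) * drive_phase \<gamma> A f0 t + of_real (\<gamma> * \<Delta>))) (at t)"
proof -
  define h where "h = (\<lambda>t. of_real (\<gamma> * (t * \<Delta> - x0)) + drive_phase \<gamma> A f0 t)"
  \<comment> \<open>Time is made complex, so that field derivative rules apply; restriction to the
    real line then gives the vector derivative of \<open>h\<close>.\<close>
  have "((\<lambda>z. of_real \<gamma> * (z * of_real \<Delta> - of_real x0)
            + of_real \<gamma> * A * exp (\<i> * (of_real (2 * pi * f0) * z)))
          has_field_derivative
          (\<i> * of_real (2 * pi * f0) * drive_phase \<gamma> A f0 t + of_real (\<gamma> * \<Delta>))) (at (of_real t))"
    by (auto intro!: derivative_eq_intros simp: drive_phase_def algebra_simps)
  from has_vector_derivative_real_field[OF this]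
  have h: "(h has_vector_derivative
      (\<i> * of_real (2 * pi * f0) * drive_phase \<gamma> A f0 t + of_real (\<gamma> * \<Delta>))) (at t)"
    by (simp add: h_def drive_phase_def)
  have "\<bar>Im (h t)\<bar> < pi"
    using abs_Im_le_cmod[of "drive_phase \<gamma> A f0 t"] assms by (simp add: h_def norm_drive_phase)
  then have "(langevin has_field_derivative deriv langevin (h t)) (at (h t))"
    by (intro holomorphic_derivI[OF holomorphic_langevin open_strip]) simp
  then have "((\<lambda>z. of_real (b1 x0) * langevin z) has_field_derivative
      of_real (b1 x0) * deriv langevin (h t)) (at (h t))"
    by (rule DERIV_cmult)
  from field_vector_diff_chain_at[OF h this] show ?thesis
    by (simp add: h_def o_def particle_response_point_source[abs_def] ffp_trajectory_drive_phase
        mult.commute)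
qed

text \<open>Taylor expansion of \<open>deriv langevin\<close> about the real point \<open>u\<close>,
  multiplied by \<open>w\<close>. This factor raises the power of \<open>w\<close> by one but leaves
  the factorial alone, whence \<open>fact (k - 1)\<close> beside the \<open>k\<close>-th
  power.\<close>

lemma harmonic_sums:
  assumes "cmod (of_real \<gamma> * A) < pi"
  shows "(\<lambda>k. harmonic_term \<gamma> A f0 x0 \<Delta> t (Suc k)) sums
    (drive_phase \<gamma> A f0 t
      * deriv langevin (of_real (\<gamma> * (t * \<Delta> - x0)) + drive_phase \<gamma> A f0 t))"
proof -
  define u :: complex where "u = of_real (\<gamma> * (t * \<Delta> - x0))"
  define w where "w = drive_phase \<gamma> A f0 t"
  \<comment> \<open>Since \<open>u\<close> is real, the disc of radius \<open>pi\<close> about it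
    stays in the strip; the amplitude bound then puts \<open>u + w\<close> inside this disc.\<close>
  have "ball u pi \<subseteq> {z. \<bar>Im z\<bar> < pi}"
  proof
    fix z assume "z \<in> ball u pi"
    then show "z \<in> {z. \<bar>Im z\<bar> < pi}"
      using abs_Im_le_cmod[of "u - z"] by (simp add: u_def dist_norm)
  qed
  then have "deriv langevin holomorphic_on ball u pi"
    by (intro holomorphic_deriv holomorphic_on_subset[OF holomorphic_langevin]) auto
  moreover have "u + w \<in> ball u pi"
    using assms by (simp add: w_def dist_norm norm_drive_phase)
  ultimately have "(\<lambda>k. (deriv ^^ k) (deriv langevin) u / fact k * (u + w - u) ^ k)
      sums deriv langevin (u + w)"
    by (rule holomorphic_power_series)
  then have "(\<lambda>k. w * ((deriv ^^ k) (deriv langevin) u / fact k * w ^ k))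
      sums (w * deriv langevin (u + w))"
    by (intro sums_mult) simp
  moreover have "harmonic_term \<gamma> A f0 x0 \<Delta> t (Suc k)
      = w * ((deriv ^^ k) (deriv langevin) u / fact k * w ^ k)" for k
  proof -
    have "exp (\<i> * of_real (2 * pi * f0 * real (Suc k) * t))
        = exp (\<i> * of_real (2 * pi * f0 * t)) ^ Suc k"
      by (simp only: exp_of_nat_mult[symmetric]) (simp add: algebra_simps)
    then show ?thesis
      by (simp add: harmonic_term_def w_def drive_phase_def u_def funpow_Suc_right
          power_mult_distrib del: funpow.simps)
  qed
  ultimately show ?thesis
    by (simp add: u_def w_def)
qed

theorem theorem1:
  fixes m \<gamma> f0 x0 :: real and A :: complex and b1 :: "real \<Rightarrow> real"
  assumes "\<gamma> > 0"
    and "cmod (of_real \<gamma> * A) < pi"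
  shows "(\<forall>\<Delta> t. particle_response b1 (point_source x0) \<gamma> (ffp_trajectory A f0 \<Delta>)
             differentiable (at t))
       \<and> (\<forall>\<Delta> t. summable (\<lambda>k. harmonic_term \<gamma> A f0 x0 \<Delta> t (Suc k)))
       \<and> (\<lambda>(\<Delta>, t).
             received_signal m b1 (point_source x0) \<gamma> (ffp_trajectory A f0 \<Delta>) t
             - \<i> * of_real (2 * pi * m * f0 * b1 x0)
               * (\<Sum>k. harmonic_term \<gamma> A f0 x0 \<Delta> t (Suc k)))
         \<in> O[nhds 0 \<times>\<^sub>F top](\<lambda>(\<Delta>, t). of_real \<Delta>)"
proof (intro conjI allI)
  note D = particle_response_has_vector_derivative[OF assms(2)]
  note S = harmonic_sums[OF assms(2)]
  show "particle_response b1 (point_source x0) \<gamma> (ffp_trajectory A f0 \<Delta>) differentiable (at t)"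
    for \<Delta> t
    using D by (rule differentiableI_vector)
  show "summable (\<lambda>k. harmonic_term \<gamma> A f0 x0 \<Delta> t (Suc k))" for \<Delta> t
    using S by (rule sums_summable)
  define z where "z = (\<lambda>\<Delta> t. of_real (\<gamma> * (t * \<Delta> - x0)) + drive_phase \<gamma> A f0 t)"
  \<comment> \<open>The series cancels the sinusoidal part of the velocity exactly, so only the
    contribution of the linear shift is left.\<close>
  have remainder: "received_signal m b1 (point_source x0) \<gamma> (ffp_trajectory A f0 \<Delta>) t
      - \<i> * of_real (2 * pi * m * f0 * b1 x0)
        * (\<Sum>k. harmonic_term \<gamma> A f0 x0 \<Delta> t (Suc k))
      = of_real (m * b1 x0 * \<gamma> * \<Delta>) * deriv langevin (z \<Delta> t)" for \<Delta> t
    unfolding received_signal_def vector_derivative_at[OF D] sums_unique[OF S, symmetric] z_def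
    by (simp add: algebra_simps)
  \<comment> \<open>\<open>B\<close> depends on neither \<open>\<Delta>\<close> nor
    \<open>t\<close>, which makes the final estimate uniform in time, as the filter
    \<open>top\<close> in the second component demands.\<close>
  obtain B where B: "\<And>z. \<bar>Im z\<bar> \<le> cmod (of_real \<gamma> * A) \<Longrightarrow> cmod (deriv langevin z) \<le> B"
    using deriv_langevin_bounded[OF assms(2)] by blast
  have "cmod (deriv langevin (z \<Delta> t)) \<le> B" for \<Delta> t
    using abs_Im_le_cmod[of "drive_phase \<gamma> A f0 t"] by (intro B) (simp add: z_def norm_drive_phase)
  then have "cmod (of_real (m * b1 x0 * \<gamma> * \<Delta>) * deriv langevin (z \<Delta> t))
      \<le> \<bar>m * b1 x0 * \<gamma>\<bar> * B * \<bar>\<Delta>\<bar>" for \<Delta> t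
    using mult_left_mono[of "cmod (deriv langevin (z \<Delta> t))" B "\<bar>m * b1 x0 * \<gamma>\<bar> * \<bar>\<Delta>\<bar>"]
    by (simp add: norm_mult abs_mult mult_ac)
  then show "(\<lambda>(\<Delta>, t).
             received_signal m b1 (point_source x0) \<gamma> (ffp_trajectory A f0 \<Delta>) t
             - \<i> * of_real (2 * pi * m * f0 * b1 x0)
               * (\<Sum>k. harmonic_term \<gamma> A f0 x0 \<Delta> t (Suc k)))
         \<in> O[nhds 0 \<times>\<^sub>F top](\<lambda>(\<Delta>, t). of_real \<Delta>)"
    unfolding remainder
    by (intro bigoI[where c="\<bar>m * b1 x0 * \<gamma>\<bar> * B"] always_eventually) auto
qed

end
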